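(* For every generalized effect algebra $(E;\oplus,0)$ the following conditions are equivalent: (i) there exists a set $S$ of generalized states on $E$ that separates points; (ii) there exists an injective morphism $\varphi:E\to\mathcal{G}_D(\mathcal{H})$ for some complex Hilbert space $\mathcal{H}$ and some linear subspace $D\subseteq\mathcal{H}$ dense in $\mathcal{H}$; (iii) there exists a set $T$ and an injective morphism of generalized effect algebras from $E$ to $(\mathbb{R}^+_0)^T$.
   Context: A generalized effect algebra $(E;\oplus,0)$ is a set $E$ with an element $0\in E$ and a partial binary operation $\oplus$ such that for all $x,y,z\in E$: (GE1) $x\oplus y=y\oplus x$ if one side is defined; (GE2) $(x\oplus y)\oplus z=x\oplus(y\oplus z)$ if one side is defined; (GE3) $x\oplus y=x\oplus z$ implies $y=z$; (GE4) $x\oplus y=0$ implies $x=y=0$; (GE5) $x\oplus 0=x$. A morphism $f:E_1\to E_2$ of generalized effect algebras is a map such that whenever $a\oplus_1 b$ is defined, $f(a)\oplus_2 f(b)$ is defined and equals $f(a\oplus_1 b)$. For a complex Hilbert space $\mathcal{H}$ (inner product linear in the second argument) and a dense linear subspace $D\subseteq\mathcal{H}$, $\mathcal{G}_D(\mathcal{H})$ is the set of all positive linear operators $A:D\to\mathcal{H}$ (i.e. $\langle \mathbf{x},A\mathbf{x}\rangle\ge 0$ for all $\mathbf{x}\in D$); with $\oplus$ the usual (everywhere defined) sum of operators on $D$ and $0$ the null operator it is a generalized effect algebra. $\mathbb{R}^+_0$ is the set of nonnegative reals, a generalized effect algebra under usual addition; $(\mathbb{R}^+_0)^T$ carries componentwise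 addition. A generalized state on $E$ is a morphism $s:E\to\mathbb{R}^+_0$. A set $S$ of generalized states on $E$ separates points if ($s(a)=s(b)$ for all $s\in S$) implies $a=b$, for all $a,b\in E$. *)

theory Defs
  imports
    "HOL-Algebra.Module"
    "HOL-Analysis.Abstract_Metric_Spaces"
    "HOL-Library.Nonpos_Ints"
begin

section \<open>Generalized effect algebras\<close>

text \<open>The partial operation is option-valued, with \<open>None\<close> for ``undefined''.\<close>

record 'a gea = "'a partial_object" +
  gplus :: "'a \<Rightarrow> 'a \<Rightarrow> 'a option" (infixl \<open>\<boxplus>\<index>\<close> 65)
  gzero :: 'a

text \<open>In \<open>GE1\<close> and \<open>GE2\<close> the equations are between options, so that either both sides are
  undefined, or both are defined and equal.\<close>

locale generalized_effect_algebra =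
  fixes E :: "'a gea" (structure)
  assumes gzero_closed: "gzero E \<in> carrier E"
    and gplus_closed:
      "\<lbrakk>x \<in> carrier E; y \<in> carrier E; x \<boxplus> y = Some z\<rbrakk> \<Longrightarrow> z \<in> carrier E"
    and GE1: "\<lbrakk>x \<in> carrier E; y \<in> carrier E\<rbrakk> \<Longrightarrow> x \<boxplus> y = y \<boxplus> x"
    and GE2: "\<lbrakk>x \<in> carrier E; y \<in> carrier E; z \<in> carrier E\<rbrakk> \<Longrightarrow>
      Option.bind (x \<boxplus> y) (\<lambda>u. u \<boxplus> z) = Option.bind (y \<boxplus> z) (\<lambda>v. x \<boxplus> v)"
    and GE3: "\<lbrakk>x \<in> carrier E; y \<in> carrier E; z \<in> carrier E;
      x \<boxplus> y = Some w; x \<boxplus> z = Some w\<rbrakk> \<Longrightarrow> y = z"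
    and GE4: "\<lbrakk>x \<in> carrier E; y \<in> carrier E; x \<boxplus> y = Some (gzero E)\<rbrakk> \<Longrightarrow>
      x = gzero E \<and> y = gzero E"
    and GE5: "x \<in> carrier E \<Longrightarrow> x \<boxplus> gzero E = Some x"

definition gea_morphism :: "'a gea \<Rightarrow> 'b gea \<Rightarrow> ('a \<Rightarrow> 'b) \<Rightarrow> bool" where
  "gea_morphism E F f \<longleftrightarrow>
     f \<in> carrier E \<rightarrow> carrier F \<and>
     (\<forall>a\<in>carrier E. \<forall>b\<in>carrier E. \<forall>c.
        a \<boxplus>\<^bsub>E\<^esub> b = Some c \<longrightarrow> f a \<boxplus>\<^bsub>F\<^esub> f b = Some (f c))"

definition nonneg_real_gea :: "real gea" where
  "nonneg_real_gea =
     \<lparr>carrier = {0..}, gplus = (\<lambda>x y. Some (x + y)), gzero = 0\<rparr>"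

text \<open>Elements of the power are the extensional functions on \<open>T\<close>, so that equality of elements is
  equality of functions on \<open>T\<close>.\<close>

definition nonneg_real_power_gea :: "'t set \<Rightarrow> ('t \<Rightarrow> real) gea" where
  "nonneg_real_power_gea T =
     \<lparr>carrier = T \<rightarrow>\<^sub>E {0..},
      gplus = (\<lambda>f g. Some (\<lambda>t\<in>T. f t + g t)),
      gzero = (\<lambda>t\<in>T. 0)\<rparr>"

lemma generalized_effect_algebra_nonneg_real:
  "generalized_effect_algebra nonneg_real_gea"
  by unfold_locales (auto simp: nonneg_real_gea_def)

lemma generalized_effect_algebra_nonneg_real_power:
  fixes T :: "'t set"
  shows "generalized_effect_algebra (nonneg_real_power_gea T)"
proof -
  have eq: "u = (v :: 't \<Rightarrow> real)"
    if "u \<in> T \<rightarrow>\<^sub>E {0..}" "v \<in> T \<rightarrow>\<^sub>E {0..}" "\<And>t. t \<in> T \<Longrightarrow> u t = v t" for u v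
    using that by (rule PiE_ext)
  have at: "u t = v t" if "(\<lambda>t\<in>T. u t) = (\<lambda>t\<in>T. v t :: real)" "t \<in> T" for u v t
    using that by (metis restrict_apply')
  show ?thesis
  proof (unfold_locales, goal_cases)
    case (5 x y z w)
    then have "x t + y t = x t + z t" if "t \<in> T" for t
      using at[of "\<lambda>t. x t + y t" "\<lambda>t. x t + z t" t] that
      by (simp add: nonneg_real_power_gea_def)
    then show ?case using 5 by (intro eq[of y z]) (auto simp: nonneg_real_power_gea_def)
  next
    case (6 x y)
    have *: "x t = 0 \<and> y t = 0" if "t \<in> T" for t
    proof -
      have "x t + y t = 0"
        using 6 at[of "\<lambda>t. x t + y t" "\<lambda>t. 0" t] that by (simp add: nonneg_real_power_gea_def)
      moreover have "x t \<ge> 0" "y t \<ge> 0" using 6 that by (auto simp: nonneg_real_power_gea_def)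
      ultimately show ?thesis by linarith
    qed
    show ?case using 6 *
      by (auto simp: nonneg_real_power_gea_def intro!: eq[of x] eq[of y])
  next
    case (7 x)
    then show ?case by (auto simp: nonneg_real_power_gea_def intro!: eq[of _ x])
  qed (auto simp: nonneg_real_power_gea_def add.commute add.assoc intro!: restrict_ext add_nonneg_nonneg)
qed


section \<open>Generalized states\<close>

definition generalized_state :: "'a gea \<Rightarrow> ('a \<Rightarrow> real) \<Rightarrow> bool" where
  "generalized_state E s \<longleftrightarrow> gea_morphism E nonneg_real_gea s"

definition separates_points :: "'a gea \<Rightarrow> ('a \<Rightarrow> real) set \<Rightarrow> bool" where
  "separates_points E S \<longleftrightarrow>
     (\<forall>a\<in>carrier E. \<forall>b\<in>carrier E. (\<forall>s\<in>S. s a = s b) \<longrightarrow> a = b)"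


section \<open>Complex Hilbert spaces\<close>

definition complex_field :: "complex ring" where
  "complex_field =
     \<lparr>carrier = UNIV, mult = (*), one = 1, zero = 0, add = (+)\<rparr>"

record 'h complex_ip_space = "(complex, 'h) module" +
  cinner :: "'h \<Rightarrow> 'h \<Rightarrow> complex"

definition cnorm :: "'h complex_ip_space \<Rightarrow> 'h \<Rightarrow> real" where
  "cnorm V x = sqrt (Re (cinner V x x))"

text \<open>The library locale \<open>Metric_space\<close> demands nonnegativity and symmetry of the distance outside
  the carrier as well, hence the guard.\<close>

definition cdist :: "'h complex_ip_space \<Rightarrow> 'h \<Rightarrow> 'h \<Rightarrow> real" where
  "cdist V x y =
     (if x \<in> carrier V \<and> y \<in> carrier V then cnorm V (x \<ominus>\<^bsub>V\<^esub> y) else 0)"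

locale complex_inner_space = Module.module complex_field V
  for V :: "'h complex_ip_space" (structure) +
  assumes cinner_add_right: "\<lbrakk>x \<in> carrier V; y \<in> carrier V; z \<in> carrier V\<rbrakk> \<Longrightarrow>
      cinner V x (y \<oplus> z) = cinner V x y + cinner V x z"
    and cinner_smult_right: "\<lbrakk>x \<in> carrier V; y \<in> carrier V\<rbrakk> \<Longrightarrow>
      cinner V x (c \<odot> y) = c * cinner V x y"
    and cinner_commute: "\<lbrakk>x \<in> carrier V; y \<in> carrier V\<rbrakk> \<Longrightarrow>
      cinner V x y = cnj (cinner V y x)"
    and cinner_nonneg: "x \<in> carrier V \<Longrightarrow> cinner V x x \<in> \<real>\<^sub>\<ge>\<^sub>0"
    and cinner_eq_zero: "\<lbrakk>x \<in> carrier V; cinner V x x = 0\<rbrakk> \<Longrightarrow> x = \<zero>"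
begin

lemma cinner_add_left: "\<lbrakk>x \<in> carrier V; y \<in> carrier V; z \<in> carrier V\<rbrakk> \<Longrightarrow>
    cinner V (x \<oplus> y) z = cinner V x z + cinner V y z"
  by (metis cinner_add_right cinner_commute M.add.m_closed complex_cnj_add)

lemma smult_closed': "x \<in> carrier V \<Longrightarrow> c \<odot> x \<in> carrier V"
  by (rule smult_closed) (auto simp: complex_field_def)

lemma cinner_smult_left: "\<lbrakk>x \<in> carrier V; y \<in> carrier V\<rbrakk> \<Longrightarrow>
    cinner V (c \<odot> x) y = cnj c * cinner V x y"
  by (metis cinner_smult_right cinner_commute smult_closed' complex_cnj_mult)

lemma minus_eq_smult: "x \<in> carrier V \<Longrightarrow> \<ominus> x = (-1) \<odot> x"
proof -
  assume x: "x \<in> carrier V"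
  have "x \<oplus> (-1) \<odot> x = (1 + -1) \<odot> x"
    using smult_l_distr[of 1 "-1" x] smult_one[OF x] x by (simp add: complex_field_def)
  also have "\<dots> = \<zero>" using smult_l_null[OF x] by (simp add: complex_field_def)
  finally show ?thesis using x smult_closed'[OF x, of "-1"] by (metis M.minus_equality M.add.m_comm)
qed

lemma cinner_self: "x \<in> carrier V \<Longrightarrow> cinner V x x = of_real ((cnorm V x)\<^sup>2)"
  using cinner_nonneg[of x]
  by (auto simp: nonneg_Reals_def cnorm_def simp flip: of_real_power)

lemma cnorm_nonneg: "x \<in> carrier V \<Longrightarrow> cnorm V x \<ge> 0"
  using cinner_nonneg[of x] by (auto simp: nonneg_Reals_def cnorm_def)

lemma cinner_add_smult_self:
  assumes "x \<in> carrier V" "y \<in> carrier V"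
  shows "cinner V (x \<oplus> c \<odot> y) (x \<oplus> c \<odot> y) =
    cinner V x x + c * cinner V x y + cnj c * cnj (cinner V x y) + c * cnj c * cinner V y y"
  using assms cinner_commute[of y x]
  by (simp add: cinner_add_left cinner_add_right cinner_smult_left cinner_smult_right
      smult_closed' algebra_simps)

lemma Cauchy_Schwarz:
  assumes x: "x \<in> carrier V" and y: "y \<in> carrier V"
  shows "cmod (cinner V x y) \<le> cnorm V x * cnorm V y"
proof (cases "cnorm V y = 0")
  case True
  then have "y = \<zero>" using cinner_self[OF y] cinner_eq_zero[OF y] by simp
  then have "y = 0 \<odot> y" using smult_l_null[OF y] by (simp add: complex_field_def)
  then have "cinner V x y = 0" using cinner_smult_right[OF x y, of 0] by simp
  then show ?thesis using True by simp
next
  case False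
  define n where "n = (cnorm V y)\<^sup>2"
  have n: "n > 0" using False by (simp add: n_def)
  define c where "c = - cnj (cinner V x y) / of_real n"
  define z where "z = x \<oplus> c \<odot> y"
  have z: "z \<in> carrier V" using x y smult_closed' by (simp add: z_def)
  have "of_real ((cnorm V z)\<^sup>2) =
      cinner V x x + c * cinner V x y + cnj c * cnj (cinner V x y) + c * cnj c * cinner V y y"
    using cinner_add_smult_self[OF x y, of c] cinner_self[OF z] unfolding z_def by (rule trans[OF sym, rotated])
  also have "\<dots> = of_real ((cnorm V x)\<^sup>2) - cinner V x y * cnj (cinner V x y) / of_real n"
    using n unfolding cinner_self[OF x] cinner_self[OF y] n_def[symmetric] c_def
    by (simp add: field_simps)
  also have "\<dots> = of_real ((cnorm V x)\<^sup>2 - (cmod (cinner V x y))\<^sup>2 / n)"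
    by (simp add: complex_norm_square[symmetric])
  finally have "(cnorm V z)\<^sup>2 = (cnorm V x)\<^sup>2 - (cmod (cinner V x y))\<^sup>2 / n"
    by (simp only: of_real_eq_iff)
  then have "(cmod (cinner V x y))\<^sup>2 / n \<le> (cnorm V x)\<^sup>2"
    by (metis diff_ge_0_iff_ge zero_le_power2)
  then have "(cmod (cinner V x y))\<^sup>2 \<le> (cnorm V x * cnorm V y)\<^sup>2"
    using n by (simp add: n_def field_simps power_mult_distrib)
  then show ?thesis using cnorm_nonneg x y by (meson mult_nonneg_nonneg power2_le_imp_le)
qed

lemma cnorm_triangle:
  assumes x: "x \<in> carrier V" and y: "y \<in> carrier V"
  shows "cnorm V (x \<oplus> y) \<le> cnorm V x + cnorm V y"
proof (rule power2_le_imp_le)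
  have xy: "x \<oplus> y \<in> carrier V" using x y by simp
  have "complex_of_real ((cnorm V (x \<oplus> y))\<^sup>2) =
      of_real ((cnorm V x)\<^sup>2) + (cinner V x y + cnj (cinner V x y)) + of_real ((cnorm V y)\<^sup>2)"
    unfolding cinner_self[OF xy, symmetric] cinner_self[OF x, symmetric] cinner_self[OF y, symmetric]
    using x y cinner_commute[OF y x] by (simp add: cinner_add_left cinner_add_right)
  also have "\<dots> = of_real ((cnorm V x)\<^sup>2 + 2 * Re (cinner V x y) + (cnorm V y)\<^sup>2)"
    by (simp add: complex_add_cnj)
  finally have "(cnorm V (x \<oplus> y))\<^sup>2 = (cnorm V x)\<^sup>2 + 2 * Re (cinner V x y) + (cnorm V y)\<^sup>2"
    by (simp only: of_real_eq_iff)
  moreover have "Re (cinner V x y) \<le> cnorm V x * cnorm V y"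
    using Cauchy_Schwarz[OF x y] complex_Re_le_cmod order_trans by blast
  ultimately show "(cnorm V (x \<oplus> y))\<^sup>2 \<le> (cnorm V x + cnorm V y)\<^sup>2"
    by (simp add: power2_sum)
qed (use cnorm_nonneg x y in simp)

lemma cnorm_uminus: "x \<in> carrier V \<Longrightarrow> cnorm V (\<ominus> x) = cnorm V x"
  by (simp add: cnorm_def minus_eq_smult cinner_smult_left cinner_smult_right smult_closed')

sublocale Metric_space "carrier V" "cdist V"
proof
  show "0 \<le> cdist V x y" for x y by (simp add: cdist_def cnorm_nonneg)
  show "cdist V x y = cdist V y x" for x y
  proof (cases "x \<in> carrier V \<and> y \<in> carrier V")
    case True
    then have "x \<ominus> y = \<ominus> (y \<ominus> x)"
      by (simp add: M.minus_eq M.minus_add M.add.m_comm)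
    then show ?thesis using True by (simp add: cdist_def cnorm_uminus)
  qed (auto simp: cdist_def)
  show "cdist V x y = 0 \<longleftrightarrow> x = y" if "x \<in> carrier V" "y \<in> carrier V" for x y
  proof
    assume "cdist V x y = 0"
    then have "x \<ominus> y = \<zero>"
      using that cinner_self[of "x \<ominus> y"] cinner_eq_zero[of "x \<ominus> y"] by (simp add: cdist_def)
    then show "x = y" using that by (metis M.minus_eq M.minus_equality M.minus_minus M.a_inv_closed)
  next
    assume "x = y"
    moreover have "cinner V \<zero> \<zero> = 0"
      using cinner_smult_right[of \<zero> \<zero> 0] smult_l_null[of \<zero>]
      by (simp add: complex_field_def)
    ultimately show "cdist V x y = 0" using that
      by (simp add: cdist_def cnorm_def M.minus_eq M.r_neg)
  qed
  show "cdist V x z \<le> cdist V x y + cdist V y z"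
    if "x \<in> carrier V" "y \<in> carrier V" "z \<in> carrier V" for x y z
  proof -
    have "x \<ominus> z = (x \<ominus> y) \<oplus> (y \<ominus> z)"
      using that by (simp add: M.minus_eq M.a_assoc M.r_neg1)
    then show ?thesis using that cnorm_triangle[of "x \<ominus> y" "y \<ominus> z"] by (simp add: cdist_def)
  qed
qed

end

locale complex_hilbert_space = complex_inner_space +
  assumes complete: mcomplete

definition dense_subspace :: "'h complex_ip_space \<Rightarrow> 'h set \<Rightarrow> bool" where
  "dense_subspace V D \<longleftrightarrow>
     submodule D complex_field V \<and>
     Metric_space.mtopology (carrier V) (cdist V) closure_of D = carrier V"


section \<open>Positive operators on a dense domain\<close>

text \<open>Operators with domain \<open>D\<close> are extensional functions on \<open>D\<close>, so that equality of operators is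
  equality of functions on \<open>D\<close>.\<close>

definition positive_operators :: "'h complex_ip_space \<Rightarrow> 'h set \<Rightarrow> ('h \<Rightarrow> 'h) set" where
  "positive_operators V D =
     {A \<in> D \<rightarrow>\<^sub>E carrier V.
        (\<forall>x\<in>D. \<forall>y\<in>D. A (x \<oplus>\<^bsub>V\<^esub> y) = A x \<oplus>\<^bsub>V\<^esub> A y) \<and>
        (\<forall>c. \<forall>x\<in>D. A (c \<odot>\<^bsub>V\<^esub> x) = c \<odot>\<^bsub>V\<^esub> A x) \<and>
        (\<forall>x\<in>D. cinner V x (A x) \<in> \<real>\<^sub>\<ge>\<^sub>0)}"

definition positive_operator_gea :: "'h complex_ip_space \<Rightarrow> 'h set \<Rightarrow> ('h \<Rightarrow> 'h) gea" where
  "positive_operator_gea V D =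
     \<lparr>carrier = positive_operators V D,
      gplus = (\<lambda>A B. Some (\<lambda>x\<in>D. A x \<oplus>\<^bsub>V\<^esub> B x)),
      gzero = (\<lambda>x\<in>D. \<zero>\<^bsub>V\<^esub>)\<rparr>"


section \<open>The three conditions\<close>

definition has_separating_states :: "'a gea \<Rightarrow> bool" where
  "has_separating_states E \<longleftrightarrow>
     (\<exists>S. (\<forall>s\<in>S. generalized_state E s) \<and> separates_points E S)"

text \<open>HOL cannot quantify over types inside a formula. The type argument of the next two predicates
  is the type over whose subsets the Hilbert spaces, respectively the sets \<open>T\<close>, range.\<close>

definition operator_representable :: "'h itself \<Rightarrow> 'a gea \<Rightarrow> bool" where
  "operator_representable _ E \<longleftrightarrow>
     (\<exists>(V :: 'h complex_ip_space) D \<phi>.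
        complex_hilbert_space V \<and> dense_subspace V D \<and>
        gea_morphism E (positive_operator_gea V D) \<phi> \<and> inj_on \<phi> (carrier E))"

definition real_power_embeddable :: "'t itself \<Rightarrow> 'a gea \<Rightarrow> bool" where
  "real_power_embeddable _ E \<longleftrightarrow>
     (\<exists>(T :: 't set) \<phi>.
        gea_morphism E (nonneg_real_power_gea T) \<phi> \<and> inj_on \<phi> (carrier E))"

end

theory Submission
  imports Defs "HOL-Analysis.Infinite_Sum"
begin

text \<open>A separating set \<open>S\<close> of states represents \<open>a\<close> by the diagonal operator with entries \<open>s a\<close>,
  \<open>s \<in> S\<close>, on the finitely supported vectors of \<open>\<ell>\<^sup>2(S)\<close>; such operators may be unbounded, whence the
  dense domain. Conversely every vector \<open>x \<in> D\<close> yields the state \<open>a \<mapsto> \<langle>x, \<phi>(a) x\<rangle>\<close>, and these states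
  separate points because polarization on \<open>D\<close> and density of \<open>D\<close> recover an operator from its
  quadratic form.\<close>

section \<open>The Hilbert space of square-summable families\<close>

text \<open>Summability ranges over the whole index type; the carrier of \<open>ell2 S\<close>
  confines vectors to \<open>S\<close> by making them vanish elsewhere, so all sums can run over
  \<open>UNIV\<close>.\<close>

definition square_summable :: "('i \<Rightarrow> complex) \<Rightarrow> bool" where
  "square_summable f \<longleftrightarrow> (\<lambda>i. (cmod (f i))\<^sup>2) summable_on UNIV"

text \<open>For nonnegative terms, bounded finite partial sums suffice, which reduces closure under
  addition and completeness to finite estimates.\<close>

lemma square_summableI:
  assumes "\<And>F. finite F \<Longrightarrow> (\<Sum>i\<in>F. (cmod (f i))\<^sup>2) \<le> B"
  shows "square_summable f"
  unfolding square_summable_def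
  by (rule nonneg_bdd_above_summable_on) (use assms in \<open>auto intro!: bdd_aboveI[of _ B]\<close>)

lemma square_summable_sum_le:
  assumes "square_summable f" "finite F"
  shows "(\<Sum>i\<in>F. (cmod (f i))\<^sup>2) \<le> (\<Sum>\<^sub>\<infinity>i. (cmod (f i))\<^sup>2)"
  using assms by (intro finite_sum_le_infsum) (auto simp: square_summable_def)

lemma square_summable_finite_support:
  assumes "finite {i. f i \<noteq> 0}"
  shows "square_summable f"
proof (rule square_summableI)
  fix F :: "'a set" assume F: "finite F"
  have "(\<Sum>i\<in>F. (cmod (f i))\<^sup>2) = (\<Sum>i\<in>F \<inter> {i. f i \<noteq> 0}. (cmod (f i))\<^sup>2)"
    using F by (intro sum.mono_neutral_right) auto
  also have "\<dots> \<le> (\<Sum>i\<in>{i. f i \<noteq> 0}. (cmod (f i))\<^sup>2)"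
    using assms by (intro sum_mono2) auto
  finally show "(\<Sum>i\<in>F. (cmod (f i))\<^sup>2) \<le> (\<Sum>i\<in>{i. f i \<noteq> 0}. (cmod (f i))\<^sup>2)" .
qed

lemma square_summable_smult:
  "square_summable f \<Longrightarrow> square_summable (\<lambda>i. c * f i)"
  unfolding square_summable_def norm_mult power_mult_distrib by (rule summable_on_cmult_right)

lemma square_summable_uminus:
  "square_summable f \<Longrightarrow> square_summable (\<lambda>i. - f i)"
  by (simp add: square_summable_def)

text \<open>The triangle inequality followed by \<open>2ab \<le> a^2 + b^2\<close>. This crude bound
  gives closure under addition.\<close>

lemma cmod_add_square_le: "(cmod (a + b))\<^sup>2 \<le> 2 * (cmod a)\<^sup>2 + 2 * (cmod b)\<^sup>2"
proof -
  have "(cmod (a + b))\<^sup>2 \<le> (cmod a + cmod b)\<^sup>2"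
    by (intro power_mono norm_triangle_ineq norm_ge_zero)
  also have "\<dots> \<le> 2 * (cmod a)\<^sup>2 + 2 * (cmod b)\<^sup>2"
    using sum_squares_bound[of "cmod a" "cmod b"] by (simp add: power2_sum)
  finally show ?thesis .
qed

lemma square_summable_add:
  assumes f: "square_summable f" and g: "square_summable g"
  shows "square_summable (\<lambda>i. f i + g i)"
proof (rule square_summableI)
  fix F :: "'a set" assume "finite F"
  have "(\<Sum>i\<in>F. (cmod (f i + g i))\<^sup>2) \<le> (\<Sum>i\<in>F. 2 * (cmod (f i))\<^sup>2 + 2 * (cmod (g i))\<^sup>2)"
    by (intro sum_mono cmod_add_square_le)
  also have "\<dots> = 2 * (\<Sum>i\<in>F. (cmod (f i))\<^sup>2) + 2 * (\<Sum>i\<in>F. (cmod (g i))\<^sup>2)"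
    by (simp add: sum.distrib sum_distrib_left)
  also have "\<dots> \<le> 2 * (\<Sum>\<^sub>\<infinity>i. (cmod (f i))\<^sup>2) + 2 * (\<Sum>\<^sub>\<infinity>i. (cmod (g i))\<^sup>2)"
    using square_summable_sum_le[OF f \<open>finite F\<close>] square_summable_sum_le[OF g \<open>finite F\<close>] by simp
  finally show "(\<Sum>i\<in>F. (cmod (f i + g i))\<^sup>2) \<le>
    2 * (\<Sum>\<^sub>\<infinity>i. (cmod (f i))\<^sup>2) + 2 * (\<Sum>\<^sub>\<infinity>i. (cmod (g i))\<^sup>2)" .
qed

text \<open>Absolute convergence makes the inner product of \<open>ell2\<close> a genuine sum;
  \<open>infsum\<close> defaults to 0 on families that are not summable.\<close>

lemma square_summable_product:
  assumes "square_summable f" "square_summable g"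
  shows "(\<lambda>i. cnj (f i) * g i) summable_on UNIV"
proof (rule abs_summable_summable)
  show "(\<lambda>i. cnj (f i) * g i) abs_summable_on UNIV"
    by (rule abs_summable_product)
      (use assms in \<open>simp_all add: square_summable_def norm_mult norm_power flip: power2_eq_square\<close>)
qed

lemma infsum_cnj_mult_self:
  assumes "square_summable f"
  shows "(\<Sum>\<^sub>\<infinity>i. cnj (f i) * f i) = of_real (\<Sum>\<^sub>\<infinity>i. (cmod (f i))\<^sup>2)"
proof -
  have "cnj (f i) * f i = of_real ((cmod (f i))\<^sup>2)" for i
    by (metis complex_norm_square mult.commute)
  moreover have "((\<lambda>i. complex_of_real ((cmod (f i))\<^sup>2)) has_sum of_real (\<Sum>\<^sub>\<infinity>i. (cmod (f i))\<^sup>2)) UNIV"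
    using assms unfolding square_summable_def
    by (intro has_sum_of_real has_sum_infsum)
  ultimately show ?thesis by (simp add: infsumI)
qed

text \<open>The fields \<open>mult\<close> and \<open>one\<close> are inherited from the ring record and play no role in a module.\<close>

definition ell2 :: "'i set \<Rightarrow> ('i \<Rightarrow> complex) complex_ip_space" where
  "ell2 S =
     \<lparr>carrier = {f. square_summable f \<and> (\<forall>i. i \<notin> S \<longrightarrow> f i = 0)},
      monoid.mult = (\<lambda>f g i. f i * g i), one = (\<lambda>i. 1),
      zero = (\<lambda>i. 0), add = (\<lambda>f g i. f i + g i),
      smult = (\<lambda>c f i. c * f i),
      cinner = (\<lambda>f g. \<Sum>\<^sub>\<infinity>i. cnj (f i) * g i)\<rparr>"

lemma ell2_simps [simp]:
  "carrier (ell2 S) = {f. square_summable f \<and> (\<forall>i. i \<notin> S \<longrightarrow> f i = 0)}"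
  "zero (ell2 S) = (\<lambda>i. 0)"
  "add (ell2 S) f g = (\<lambda>i. f i + g i)"
  "smult (ell2 S) c f = (\<lambda>i. c * f i)"
  "cinner (ell2 S) f g = (\<Sum>\<^sub>\<infinity>i. cnj (f i) * g i)"
  by (simp_all add: ell2_def)

section \<open>Inner product structure of \<open>ell2 S\<close>\<close>

lemma cring_complex_field: "cring complex_field"
proof (rule cringI)
  show "abelian_group complex_field"
  proof (rule abelian_groupI, goal_cases)
    case (6 x)
    show ?case by (rule bexI[of _ "- x"]) (auto simp: complex_field_def)
  qed (auto simp: complex_field_def algebra_simps)
  show "comm_monoid complex_field"
    by (rule comm_monoidI) (auto simp: complex_field_def algebra_simps)
qed (auto simp: complex_field_def algebra_simps)

lemma module_ell2: "Module.module complex_field (ell2 S)"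
proof (rule Module.moduleI[OF cring_complex_field])
  have 0: "square_summable (\<lambda>i. 0 :: complex)"
    by (rule square_summable_finite_support) simp
  show "abelian_group (ell2 S)"
  proof (rule abelian_groupI, goal_cases)
    case (6 f)
    then show ?case
      by (intro bexI[of _ "\<lambda>i. - f i"]) (auto simp: square_summable_uminus)
  qed (use 0 in \<open>auto simp: square_summable_add algebra_simps\<close>)
qed (auto simp: complex_field_def square_summable_smult algebra_simps)

interpretation ell2: complex_inner_space "ell2 S"
proof (rule complex_inner_space.intro[OF module_ell2], unfold_locales, goal_cases)
  case (1 f g h)
  then have "(\<lambda>i. cnj (f i) * g i) summable_on UNIV" "(\<lambda>i. cnj (f i) * h i) summable_on UNIV"
    by (simp_all add: square_summable_product)
  from infsum_add[OF this] show ?case by (simp add: algebra_simps)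
next
  case (2 f g c)
  show ?case using infsum_cmult_right'[of c "\<lambda>i. cnj (f i) * g i" UNIV]
    by (simp add: algebra_simps)
next
  case (3 f g)
  show ?case by (simp add: mult.commute flip: infsum_cnj)
next
  case (4 f)
  then show ?case by (simp add: infsum_cnj_mult_self infsum_nonneg)
next
  case (5 f)
  then have f: "square_summable f" and "(\<Sum>\<^sub>\<infinity>i. (cmod (f i))\<^sup>2) = 0"
    by (simp_all add: infsum_cnj_mult_self)
  then have "(cmod (f i))\<^sup>2 = 0" for i
    using nonneg_infsum_le_0D[of "\<lambda>i. (cmod (f i))\<^sup>2" UNIV i] by (simp add: square_summable_def)
  then show ?case by auto
qed

section \<open>Distance and completeness\<close>

lemma cdist_ell2:
  assumes "f \<in> carrier (ell2 S)" "g \<in> carrier (ell2 S)"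
  shows "cdist (ell2 S) f g = sqrt (\<Sum>\<^sub>\<infinity>i. (cmod (f i - g i))\<^sup>2)"
    and "square_summable (\<lambda>i. f i - g i)"
proof -
  have *: "f \<ominus>\<^bsub>ell2 S\<^esub> g = (\<lambda>i. f i - g i)"
    using assms ell2.minus_eq_smult[of g S] by (simp add: a_minus_def)
  show sq: "square_summable (\<lambda>i. f i - g i)"
    using assms square_summable_add[of f "\<lambda>i. - g i"] by (simp add: square_summable_uminus)
  show "cdist (ell2 S) f g = sqrt (\<Sum>\<^sub>\<infinity>i. (cmod (f i - g i))\<^sup>2)"
    unfolding cdist_def cnorm_def * using assms infsum_cnj_mult_self[OF sq] by simp
qed

text \<open>Together with \<open>cdist_ell2_le\<close> this controls the distance through finite
  sums alone, and finite sums commute with coordinatewise limits.\<close>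

lemma sum_le_cdist_ell2:
  assumes "f \<in> carrier (ell2 S)" "g \<in> carrier (ell2 S)" "finite F"
  shows "(\<Sum>i\<in>F. (cmod (f i - g i))\<^sup>2) \<le> (cdist (ell2 S) f g)\<^sup>2"
  using square_summable_sum_le[OF cdist_ell2(2)[OF assms(1,2)] assms(3)]
  by (simp add: cdist_ell2(1)[OF assms(1,2)] infsum_nonneg)

lemma cdist_ell2_le:
  assumes "f \<in> carrier (ell2 S)" "g \<in> carrier (ell2 S)" "0 \<le> r"
    "\<And>F. finite F \<Longrightarrow> (\<Sum>i\<in>F. (cmod (f i - g i))\<^sup>2) \<le> r\<^sup>2"
  shows "cdist (ell2 S) f g \<le> r"
proof -
  have "(\<Sum>\<^sub>\<infinity>i. (cmod (f i - g i))\<^sup>2) \<le> r\<^sup>2"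
    using cdist_ell2(2)[OF assms(1,2)] assms(4)
    by (intro infsum_le_finite_sums) (auto simp: square_summable_def)
  then show ?thesis
    using assms(3) by (simp add: cdist_ell2(1)[OF assms(1,2)] real_le_lsqrt infsum_nonneg)
qed

text \<open>A Cauchy sequence converges in each coordinate by completeness of the complex numbers;
  the Cauchy estimates on finite sums survive the limit and show that the coordinatewise limit is a
  limit in norm.\<close>

lemma complex_hilbert_space_ell2: "complex_hilbert_space (ell2 S)"
proof (unfold_locales, unfold ell2.mcomplete_def, intro allI impI)
  fix \<sigma> assume "Metric_space.MCauchy (carrier (ell2 S)) (cdist (ell2 S)) \<sigma>"
  then have range: "range \<sigma> \<subseteq> carrier (ell2 S)"
    and Cauchy: "\<And>e. e > 0 \<Longrightarrow> \<exists>N. \<forall>n n'. N \<le> n \<longrightarrow> N \<le> n' \<longrightarrow> cdist (ell2 S) (\<sigma> n) (\<sigma> n') < e"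
    unfolding ell2.MCauchy_def by blast+
  have \<sigma>: "\<sigma> n \<in> carrier (ell2 S)" for n using range by blast
  have "convergent (\<lambda>n. \<sigma> n i)" for i
  proof (rule Cauchy_convergent, rule metric_CauchyI)
    fix e :: real assume "e > 0"
    then obtain N where N: "\<And>n n'. N \<le> n \<Longrightarrow> N \<le> n' \<Longrightarrow> cdist (ell2 S) (\<sigma> n) (\<sigma> n') < e"
      using Cauchy by blast
    have "cmod (\<sigma> n i - \<sigma> n' i) \<le> cdist (ell2 S) (\<sigma> n) (\<sigma> n')" for n n'
      by (rule power2_le_imp_le) (use sum_le_cdist_ell2[OF \<sigma> \<sigma>, of "{i}"] in auto)
    with N show "\<exists>M. \<forall>m\<ge>M. \<forall>n\<ge>M. dist (\<sigma> m i) (\<sigma> n i) < e"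
      by (metis dist_norm le_less_trans)
  qed
  then obtain f where f: "\<And>i. (\<lambda>n. \<sigma> n i) \<longlonglongrightarrow> f i"
    unfolding convergent_def by metis
  \<comment> \<open>The index \<open>N\<close> does not depend on \<open>F\<close>: for fixed
    \<open>n\<close> and \<open>F\<close> the other index \<open>n'\<close> tends to infinity in the
    Cauchy estimate.\<close>
  have close: "\<exists>N. \<forall>n\<ge>N. \<forall>F. finite F \<longrightarrow> (\<Sum>i\<in>F. (cmod (\<sigma> n i - f i))\<^sup>2) \<le> e\<^sup>2"
    if "e > 0" for e
  proof -
    obtain N where N: "\<And>n n'. N \<le> n \<Longrightarrow> N \<le> n' \<Longrightarrow> cdist (ell2 S) (\<sigma> n) (\<sigma> n') < e"
      using Cauchy[OF \<open>e > 0\<close>] by blast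
    have "(\<Sum>i\<in>F. (cmod (\<sigma> n i - f i))\<^sup>2) \<le> e\<^sup>2" if "n \<ge> N" "finite F" for n F
    proof (rule LIMSEQ_le_const2)
      show "(\<lambda>n'. \<Sum>i\<in>F. (cmod (\<sigma> n i - \<sigma> n' i))\<^sup>2) \<longlonglongrightarrow> (\<Sum>i\<in>F. (cmod (\<sigma> n i - f i))\<^sup>2)"
        by (intro tendsto_intros f)
      have "(\<Sum>i\<in>F. (cmod (\<sigma> n i - \<sigma> n' i))\<^sup>2) \<le> e\<^sup>2" if "n' \<ge> N" for n'
      proof -
        have "(cdist (ell2 S) (\<sigma> n) (\<sigma> n'))\<^sup>2 \<le> e\<^sup>2"
          using N[OF \<open>n \<ge> N\<close> that] by (intro power_mono) auto
        then show ?thesis using sum_le_cdist_ell2[OF \<sigma> \<sigma> \<open>finite F\<close>] order_trans by blast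
      qed
      then show "\<exists>M. \<forall>n'\<ge>M. (\<Sum>i\<in>F. (cmod (\<sigma> n i - \<sigma> n' i))\<^sup>2) \<le> e\<^sup>2" by blast
    qed
    then show ?thesis by blast
  qed
  have fS: "f \<in> carrier (ell2 S)"
  proof -
    \<comment> \<open>One index at finite distance is enough: \<open>f\<close> is recovered as
      \<open>\<sigma> n\<close> minus the square-summable difference
      \<open>\<sigma> n - f\<close>.\<close>
    obtain n where "\<And>F. finite F \<Longrightarrow> (\<Sum>i\<in>F. (cmod (\<sigma> n i - f i))\<^sup>2) \<le> 1\<^sup>2"
      using close[of 1] by auto
    then have "square_summable (\<lambda>i. \<sigma> n i - f i)" by (rule square_summableI)
    then have "square_summable (\<lambda>i. \<sigma> n i + - (\<sigma> n i - f i))"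
      using \<sigma>[of n] by (intro square_summable_add square_summable_uminus) auto
    moreover have "f i = 0" if "i \<notin> S" for i
      using LIMSEQ_unique[OF f[of i]] \<sigma> that by simp
    ultimately show ?thesis by simp
  qed
  have "limitin (Metric_space.mtopology (carrier (ell2 S)) (cdist (ell2 S))) \<sigma> f sequentially"
    unfolding ell2.limit_metric_sequentially
  proof (intro conjI allI impI fS)
    fix e :: real assume "e > 0"
    \<comment> \<open>Halving \<open>e\<close> turns the non-strict bound of \<open>close\<close>
      into the strict one required by the limit.\<close>
    then obtain N where N: "\<And>n F. n \<ge> N \<Longrightarrow> finite F \<Longrightarrow> (\<Sum>i\<in>F. (cmod (\<sigma> n i - f i))\<^sup>2) \<le> (e/2)\<^sup>2"
      using close[of "e/2"] by auto
    have "cdist (ell2 S) (\<sigma> n) f < e" if "n \<ge> N" for n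
      using cdist_ell2_le[OF \<sigma> fS, of "e/2" n] N[OF that] \<open>e > 0\<close> by auto
    then show "\<exists>N. \<forall>n\<ge>N. \<sigma> n \<in> carrier (ell2 S) \<and> cdist (ell2 S) (\<sigma> n) f < e"
      using \<sigma> by blast
  qed
  then show "\<exists>x. limitin (Metric_space.mtopology (carrier (ell2 S)) (cdist (ell2 S))) \<sigma> x sequentially"
    by blast
qed

section \<open>The dense domain of finitely supported vectors\<close>

definition finitely_supported :: "'i set \<Rightarrow> ('i \<Rightarrow> complex) set" where
  "finitely_supported S = {f. finite {i. f i \<noteq> 0} \<and> (\<forall>i. i \<notin> S \<longrightarrow> f i = 0)}"

lemma finitely_supported_subset: "finitely_supported S \<subseteq> carrier (ell2 S)"
  by (auto simp: finitely_supported_def square_summable_finite_support)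

lemma finitely_supported_add:
  assumes "f \<in> finitely_supported S" "g \<in> finitely_supported S"
  shows "(\<lambda>i. f i + g i) \<in> finitely_supported S"
proof -
  have "finite {i. f i + g i \<noteq> 0}"
    by (rule finite_subset[of _ "{i. f i \<noteq> 0} \<union> {i. g i \<noteq> 0}"])
      (use assms in \<open>auto simp: finitely_supported_def\<close>)
  then show ?thesis using assms by (simp add: finitely_supported_def)
qed

text \<open>Supports only shrink under pointwise multiplication. Constant \<open>c\<close> gives
  scalar multiples, general \<open>c\<close> the diagonal operators.\<close>

lemma finitely_supported_mult:
  assumes "f \<in> finitely_supported S"
  shows "(\<lambda>i. c i * f i) \<in> finitely_supported S"
  using assms by (auto simp: finitely_supported_def elim: rev_finite_subset)

text \<open>For density, a square-summable family is truncated to a finite set outside which its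
  squares sum to little.\<close>

lemma dense_subspace_finitely_supported: "dense_subspace (ell2 S) (finitely_supported S)"
  unfolding dense_subspace_def
proof
  show "submodule (finitely_supported S) complex_field (ell2 S)"
  proof (rule module.submoduleI[OF module_ell2 finitely_supported_subset])
    show "\<ominus>\<^bsub>ell2 S\<^esub> f \<in> finitely_supported S" if "f \<in> finitely_supported S" for f
      using that finitely_supported_subset[of S] ell2.minus_eq_smult[of f S]
        finitely_supported_mult[OF that, of "\<lambda>_. -1"] by auto
  qed (auto simp: finitely_supported_add finitely_supported_mult, auto simp: finitely_supported_def)
  have "\<exists>g\<in>finitely_supported S. g \<in> ell2.mball S f r" if f: "f \<in> carrier (ell2 S)" and r: "r > 0" for f r
  proof -
    have sm: "(\<lambda>i. (cmod (f i))\<^sup>2) summable_on UNIV"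
      using f by (simp add: square_summable_def)
    obtain F where F: "finite F"
      "dist (\<Sum>i\<in>F. (cmod (f i))\<^sup>2) (\<Sum>\<^sub>\<infinity>i. (cmod (f i))\<^sup>2) \<le> (r/2)\<^sup>2"
      using infsum_finite_approximation[OF sm, of "(r/2)\<^sup>2"] r by auto
    define g where "g = (\<lambda>i. if i \<in> F then f i else 0)"
    have g: "g \<in> finitely_supported S"
      using f F(1) by (auto simp: finitely_supported_def g_def elim: rev_finite_subset)
    then have gS: "g \<in> carrier (ell2 S)" using finitely_supported_subset by blast
    have "(\<Sum>i\<in>G. (cmod (f i - g i))\<^sup>2) \<le> (r/2)\<^sup>2" if "finite G" for G
    proof -
      have "(\<Sum>i\<in>G. (cmod (f i - g i))\<^sup>2) = (\<Sum>i\<in>G - F. (cmod (f i))\<^sup>2)"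
        using that by (intro sum.mono_neutral_cong_right) (auto simp: g_def)
      \<comment> \<open>Enlarging \<open>G\<close> by \<open>F\<close> leaves \<open>G - F\<close>
        unchanged and makes it a difference of nested sets, so the full sum minus the part over
        \<open>F\<close> bounds it.\<close>
      also have "\<dots> = (\<Sum>i\<in>G \<union> F. (cmod (f i))\<^sup>2) - (\<Sum>i\<in>F. (cmod (f i))\<^sup>2)"
        using that F(1) sum_diff[of "G \<union> F" F "\<lambda>i. (cmod (f i))\<^sup>2"] by (simp add: Un_Diff)
      also have "\<dots> \<le> (\<Sum>\<^sub>\<infinity>i. (cmod (f i))\<^sup>2) - (\<Sum>i\<in>F. (cmod (f i))\<^sup>2)"
        using that F(1) f by (intro diff_right_mono square_summable_sum_le) auto
      also have "\<dots> \<le> (r/2)\<^sup>2" using F(2) by (simp add: dist_real_def)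
      finally show ?thesis .
    qed
    then have "cdist (ell2 S) f g \<le> r/2" using f gS r by (intro cdist_ell2_le) auto
    then have "g \<in> ell2.mball S f r"
      unfolding ell2.in_mball using f gS r by auto
    with g show ?thesis by blast
  qed
  then show "Metric_space.mtopology (carrier (ell2 S)) (cdist (ell2 S)) closure_of finitely_supported S
      = carrier (ell2 S)"
    unfolding ell2.metric_closure_of by blast
qed


section \<open>Diagonal operators\<close>

text \<open>The restriction matches the extensional encoding of operators in
  \<open>positive_operators\<close>.\<close>

definition diagonal_operator :: "'i set \<Rightarrow> ('i \<Rightarrow> real) \<Rightarrow> ('i \<Rightarrow> complex) \<Rightarrow> 'i \<Rightarrow> complex" where
  "diagonal_operator S w = (\<lambda>f\<in>finitely_supported S. \<lambda>i. of_real (w i) * f i)"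

text \<open>The quadratic form at \<open>f\<close> is the sum of \<open>w i * |f i|^2\<close> over
  the finite support of \<open>f\<close>, which lies in \<open>S\<close>, where the weights are
  nonnegative.\<close>

lemma diagonal_operator_positive:
  assumes "\<And>i. i \<in> S \<Longrightarrow> w i \<ge> 0"
  shows "diagonal_operator S w \<in> positive_operators (ell2 S) (finitely_supported S)"
proof -
  have "(\<Sum>\<^sub>\<infinity>i. cnj (f i) * (of_real (w i) * f i)) \<in> \<real>\<^sub>\<ge>\<^sub>0" if f: "f \<in> finitely_supported S" for f
  proof -
    have fin: "finite {i. f i \<noteq> 0}" and "{i. f i \<noteq> 0} \<subseteq> S"
      using f by (auto simp: finitely_supported_def)
    have "(\<Sum>\<^sub>\<infinity>i. cnj (f i) * (of_real (w i) * f i)) =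
        (\<Sum>\<^sub>\<infinity>i\<in>{i. f i \<noteq> 0}. cnj (f i) * (of_real (w i) * f i))"
      by (rule infsum_cong_neutral) auto
    also have "\<dots> = of_real (\<Sum>i\<in>{i. f i \<noteq> 0}. w i * (cmod (f i))\<^sup>2)"
      using fin by (simp add: complex_norm_square mult_ac del: of_real_power)
    also have "\<dots> \<in> \<real>\<^sub>\<ge>\<^sub>0"
      using assms \<open>{i. f i \<noteq> 0} \<subseteq> S\<close>
      by (subst nonneg_Reals_of_real_iff) (auto intro!: sum_nonneg)
    finally show ?thesis .
  qed
  moreover have "(\<lambda>i. of_real (w i) * f i) \<in> carrier (ell2 S)" if "f \<in> finitely_supported S" for f
    using finitely_supported_mult[OF that] finitely_supported_subset by (rule subsetD[rotated])
  ultimately show ?thesis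
    by (simp add: positive_operators_def diagonal_operator_def finitely_supported_add
        finitely_supported_mult distrib_left mult.left_commute)
qed

text \<open>The left side has the shape that \<open>gplus\<close> of
  \<open>positive_operator_gea\<close> takes over \<open>ell2 S\<close>, so rewriting collapses a
  sum of operators into one with added weights.\<close>

lemma diagonal_operator_add:
  "(\<lambda>f\<in>finitely_supported S. \<lambda>i. diagonal_operator S v f i + diagonal_operator S w f i) =
    diagonal_operator S (\<lambda>i. v i + w i)"
  by (auto simp: diagonal_operator_def algebra_simps)

text \<open>The unit vector at \<open>i\<close> lies in the domain, and coordinate \<open>i\<close>
  of its image is the weight.\<close>

lemma diagonal_operator_inject:
  assumes "diagonal_operator S v = diagonal_operator S w" "i \<in> S"
  shows "v i = w i"
proof -
  let ?e = "\<lambda>j. if j = i then 1 else 0 :: complex"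
  have "?e \<in> finitely_supported S"
    using \<open>i \<in> S\<close> by (auto simp: finitely_supported_def)
  then show ?thesis
    using fun_cong[OF fun_cong[OF assms(1), of ?e], of i] by (simp add: diagonal_operator_def)
qed


section \<open>Positive operators are determined by their quadratic forms\<close>

text \<open>If \<open>z\<close> were nonzero, some \<open>x\<close> in \<open>D\<close> would be
  closer to \<open>z\<close> than \<open>cnorm V z\<close>. Orthogonality gives
  \<open>\<langle>z - x, z\<rangle> = |z|^2\<close>, while Cauchy-Schwarz makes it strictly smaller
  in modulus.\<close>

lemma (in complex_inner_space) dense_subspace_orthogonal:
  assumes D: "dense_subspace V D" and z: "z \<in> carrier V"
    and orth: "\<And>x. x \<in> D \<Longrightarrow> cinner V x z = 0"
  shows "z = \<zero>"
proof (rule ccontr)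
  assume "z \<noteq> \<zero>"
  then have pos: "cnorm V z > 0"
    using cinner_self[OF z] cinner_eq_zero[OF z] cnorm_nonneg[OF z] by force
  have "z \<in> mtopology closure_of D" using D z by (simp add: dense_subspace_def)
  then obtain x where x: "x \<in> D" "x \<in> mball z (cnorm V z)"
    using pos unfolding metric_closure_of by blast
  then have xV: "x \<in> carrier V" and d: "cnorm V (z \<ominus> x) < cnorm V z"
    by (auto simp: cdist_def)
  have "cinner V (z \<ominus> x) z = cinner V z z - cinner V x z"
    using z xV by (simp add: M.minus_eq cinner_add_left minus_eq_smult cinner_smult_left smult_closed')
  then have "cinner V (z \<ominus> x) z = of_real ((cnorm V z)\<^sup>2)"
    using orth[OF x(1)] cinner_self[OF z] by simp
  then have "(cnorm V z)\<^sup>2 \<le> cnorm V (z \<ominus> x) * cnorm V z"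
    using Cauchy_Schwarz[of "z \<ominus> x" z] z xV by (simp add: norm_power)
  moreover have "cnorm V (z \<ominus> x) * cnorm V z < (cnorm V z)\<^sup>2"
    using d pos by (simp add: power2_eq_square)
  ultimately show False by simp
qed

text \<open>The sesquilinear form \<open>q\<close> of the difference vanishes on the diagonal, hence
  on all pairs from \<open>D\<close> since the scalars are complex. So \<open>A y - B y\<close> is
  orthogonal to the dense \<open>D\<close>.\<close>

lemma (in complex_inner_space) positive_operators_eqI:
  assumes D: "dense_subspace V D"
    and A: "A \<in> positive_operators V D" and B: "B \<in> positive_operators V D"
    and eq: "\<And>x. x \<in> D \<Longrightarrow> cinner V x (A x) = cinner V x (B x)"
  shows "A = B"
proof -
  interpret D: submodule D complex_field V using D by (simp add: dense_subspace_def)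
  have DV: "x \<in> carrier V" if "x \<in> D" for x using that D.subset by auto
  have D_add: "x \<oplus> y \<in> D" if "x \<in> D" "y \<in> D" for x y using D.m_closed[OF that] by simp
  have D_smult: "c \<odot> x \<in> D" if "x \<in> D" for c x
    using D.smult_closed[of c x] that by (simp add: complex_field_def)
  note PA = A[unfolded positive_operators_def] and PB = B[unfolded positive_operators_def]
  have AV: "A x \<in> carrier V" and BV: "B x \<in> carrier V" if "x \<in> D" for x
    using that PA PB by auto
  define q where "q x y = cinner V x (A y) - cinner V x (B y)" for x y
  have q_add_left: "q (x \<oplus> y) z = q x z + q y z" if "x \<in> D" "y \<in> D" "z \<in> D" for x y z
    using that by (simp add: q_def cinner_add_left DV AV BV)
  have q_add_right: "q x (y \<oplus> z) = q x y + q x z" if "x \<in> D" "y \<in> D" "z \<in> D" for x y z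
    using that PA PB by (simp add: q_def cinner_add_right DV AV BV)
  have q_smult_left: "q (c \<odot> x) y = cnj c * q x y" if "x \<in> D" "y \<in> D" for c x y
    using that by (simp add: q_def cinner_smult_left DV AV BV algebra_simps)
  have q_smult_right: "q x (c \<odot> y) = c * q x y" if "x \<in> D" "y \<in> D" for c x y
    using that PA PB by (simp add: q_def cinner_smult_right DV AV BV algebra_simps)
  have q_self: "q x x = 0" if "x \<in> D" for x using eq[OF that] by (simp add: q_def)
  have q_flip: "q x y + q y x = 0" if "x \<in> D" "y \<in> D" for x y
  proof -
    \<comment> \<open>In this expansion the diagonal terms are zero, which leaves the two mixed
      ones.\<close>
    have "q (x \<oplus> y) (x \<oplus> y) = q x x + q y x + (q x y + q y y)"
      using that by (simp only: q_add_left q_add_right D_add)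
    then show ?thesis using that by (simp add: q_self D_add add.commute)
  qed
  \<comment> \<open>Replacing \<open>y\<close> by \<open>\<i> y\<close> turns antisymmetry into symmetry.\<close>
  have q_zero: "q x y = 0" if "x \<in> D" "y \<in> D" for x y
  proof -
    have "\<i> * q x y - \<i> * q y x = 0"
      using q_flip[OF that(1) D_smult[OF that(2)], of \<i>] that
      by (simp add: q_smult_left q_smult_right)
    then have "q x y = q y x" by simp
    then show ?thesis using q_flip[OF that] by simp
  qed
  have "A y = B y" if y: "y \<in> D" for y
  proof -
    have "cinner V x (A y \<ominus> B y) = 0" if "x \<in> D" for x
      using q_zero[OF that y] that y
      by (simp add: q_def M.minus_eq minus_eq_smult cinner_add_right cinner_smult_right
          smult_closed' DV AV BV)
    then have "A y \<ominus> B y = \<zero>"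
      using y by (intro dense_subspace_orthogonal[OF D]) (auto simp: AV BV)
    then show ?thesis
      using AV[OF y] BV[OF y] by (metis M.minus_eq M.minus_equality M.minus_minus M.a_inv_closed)
  qed
  then show ?thesis using PA PB by (intro PiE_ext[of A D _ B]) auto
qed


section \<open>Separating states\<close>

lemma generalized_stateD:
  assumes "generalized_state E s"
  shows "a \<in> carrier E \<Longrightarrow> s a \<ge> 0"
    and "\<lbrakk>a \<in> carrier E; b \<in> carrier E; a \<boxplus>\<^bsub>E\<^esub> b = Some c\<rbrakk> \<Longrightarrow> s c = s a + s b"
  using assms by (auto simp: generalized_state_def gea_morphism_def nonneg_real_gea_def)

section \<open>Separating states and powers of the nonnegative reals\<close>

text \<open>The coordinates of the embedding serve as states; images are extensional, so agreement
  on \<open>T\<close> is equality.\<close>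

lemma real_power_embeddable_imp_states:
  assumes "real_power_embeddable TYPE('t) E"
  shows "has_separating_states E"
proof -
  obtain T :: "'t set" and \<phi> where \<phi>: "gea_morphism E (nonneg_real_power_gea T) \<phi>"
    and inj: "inj_on \<phi> (carrier E)"
    using assms by (auto simp: real_power_embeddable_def)
  have PiE: "\<phi> a \<in> T \<rightarrow>\<^sub>E {0..}" if "a \<in> carrier E" for a
    using \<phi> that by (auto simp: gea_morphism_def nonneg_real_power_gea_def)
  have add: "\<phi> c = (\<lambda>t\<in>T. \<phi> a t + \<phi> b t)"
    if "a \<in> carrier E" "b \<in> carrier E" "a \<boxplus>\<^bsub>E\<^esub> b = Some c" for a b c
    using \<phi> that by (auto simp: gea_morphism_def nonneg_real_power_gea_def)
  have "generalized_state E (\<lambda>a. \<phi> a t)" if "t \<in> T" for t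
    using PiE that by (auto simp: generalized_state_def gea_morphism_def nonneg_real_gea_def add
        dest!: PiE_mem)
  moreover have "separates_points E ((\<lambda>t a. \<phi> a t) ` T)"
    unfolding separates_points_def
  proof (intro ballI impI)
    fix a b
    assume a: "a \<in> carrier E" and b: "b \<in> carrier E"
      and "\<forall>s\<in>(\<lambda>t a. \<phi> a t) ` T. s a = s b"
    then have "\<phi> a = \<phi> b" by (intro PiE_ext[OF PiE PiE]) auto
    then show "a = b" using inj a b by (auto dest: inj_onD)
  qed
  ultimately show ?thesis unfolding has_separating_states_def
    by (intro exI[of _ "(\<lambda>t a. \<phi> a t) ` T"]) auto
qed

text \<open>The separating set is its own index set, with \<open>a\<close> sent to evaluation at
  \<open>a\<close>; hence the index type \<open>'a \<Rightarrow> real\<close>.\<close>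

lemma states_imp_real_power_embeddable:
  assumes "has_separating_states (E :: 'a gea)"
  shows "real_power_embeddable TYPE('a \<Rightarrow> real) E"
proof -
  obtain S where S: "\<And>s. s \<in> S \<Longrightarrow> generalized_state E s" and sep: "separates_points E S"
    using assms by (auto simp: has_separating_states_def)
  let ?\<phi> = "\<lambda>a. \<lambda>s\<in>S. s a"
  have "gea_morphism E (nonneg_real_power_gea S) ?\<phi>"
    using generalized_stateD[OF S]
    by (auto simp: gea_morphism_def nonneg_real_power_gea_def intro!: restrict_ext)
  moreover have "inj_on ?\<phi> (carrier E)"
  proof (rule inj_onI)
    fix a b assume "a \<in> carrier E" "b \<in> carrier E" "?\<phi> a = ?\<phi> b"
    then show "a = b" using sep unfolding separates_points_def by (metis restrict_apply')
  qed
  ultimately show ?thesis unfolding real_power_embeddable_def by blast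
qed

section \<open>Separating states and positive operators\<close>

lemma operator_representable_imp_states:
  assumes "operator_representable TYPE('h) E"
  shows "has_separating_states E"
proof -
  obtain V :: "'h complex_ip_space" and D \<phi> where "complex_hilbert_space V"
    and D: "dense_subspace V D"
    and \<phi>: "gea_morphism E (positive_operator_gea V D) \<phi>"
    and inj: "inj_on \<phi> (carrier E)"
    using assms by (auto simp: operator_representable_def)
  then interpret complex_hilbert_space V by simp
  have DV: "x \<in> carrier V" if "x \<in> D" for x
    using D that submodule.axioms(1)[of D complex_field V] subgroup.subset[of D "add_monoid V"]
    by (auto simp: dense_subspace_def)
  have pos: "\<phi> a \<in> positive_operators V D" if "a \<in> carrier E" for a
    using \<phi> that by (auto simp: gea_morphism_def positive_operator_gea_def)
  have add: "\<phi> c = (\<lambda>x\<in>D. \<phi> a x \<oplus>\<^bsub>V\<^esub> \<phi> b x)"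
    if "a \<in> carrier E" "b \<in> carrier E" "a \<boxplus>\<^bsub>E\<^esub> b = Some c" for a b c
    using \<phi> that by (auto simp: gea_morphism_def positive_operator_gea_def)
  \<comment> \<open>Positivity makes the quadratic form real, so its real part carries all of its
    information.\<close>
  let ?s = "\<lambda>x a. Re (cinner V x (\<phi> a x))"
  have nonneg: "cinner V x (\<phi> a x) \<in> \<real>\<^sub>\<ge>\<^sub>0" and closed: "\<phi> a x \<in> carrier V"
    if "a \<in> carrier E" "x \<in> D" for a x
    using pos[OF that(1)] that(2) by (auto simp: positive_operators_def)
  have real: "cinner V x (\<phi> a x) = of_real (?s x a)" "0 \<le> ?s x a" if "a \<in> carrier E" "x \<in> D" for a x
    using nonneg[OF that] by (auto simp: nonneg_Reals_def)
  have s_add: "?s x c = ?s x a + ?s x b"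
    if "a \<in> carrier E" "b \<in> carrier E" "a \<boxplus>\<^bsub>E\<^esub> b = Some c" "x \<in> D" for a b c x
    using that by (simp add: add[OF that(1-3)] cinner_add_right DV closed)
  have "generalized_state E (?s x)" if "x \<in> D" for x
    unfolding generalized_state_def gea_morphism_def
  proof (intro conjI ballI allI impI)
    show "?s x \<in> carrier E \<rightarrow> carrier nonneg_real_gea"
      using real(2)[OF _ that] by (simp add: nonneg_real_gea_def)
    show "?s x a \<boxplus>\<^bsub>nonneg_real_gea\<^esub> ?s x b = Some (?s x c)"
      if "a \<in> carrier E" "b \<in> carrier E" "a \<boxplus>\<^bsub>E\<^esub> b = Some c" for a b c
      using s_add[OF that \<open>x \<in> D\<close>] by (simp add: nonneg_real_gea_def)
  qed
  moreover have "separates_points E (?s ` D)"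
    unfolding separates_points_def
  proof (intro ballI impI)
    fix a b assume a: "a \<in> carrier E" and b: "b \<in> carrier E" and "\<forall>s\<in>?s ` D. s a = s b"
    then have "?s x a = ?s x b" if "x \<in> D" for x using that by simp
    then have "cinner V x (\<phi> a x) = cinner V x (\<phi> b x)" if "x \<in> D" for x
      using real(1)[OF a that] real(1)[OF b that] that by metis
    then have "\<phi> a = \<phi> b" by (rule positive_operators_eqI[OF D pos[OF a] pos[OF b]])
    then show "a = b" using inj a b by (auto dest: inj_onD)
  qed
  ultimately show ?thesis unfolding has_separating_states_def
    by (intro exI[of _ "?s ` D"]) auto
qed

lemma states_imp_operator_representable:
  assumes "has_separating_states (E :: 'a gea)"
  shows "operator_representable TYPE(('a \<Rightarrow> real) \<Rightarrow> complex) E"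
proof -
  obtain S where S: "\<And>s. s \<in> S \<Longrightarrow> generalized_state E s" and sep: "separates_points E S"
    using assms by (auto simp: has_separating_states_def)
  let ?\<phi> = "\<lambda>a. diagonal_operator S (\<lambda>s. s a)"
  \<comment> \<open>Additivity \<open>s c = s a + s b\<close> is known for \<open>s\<close> in
    \<open>S\<close> only; weights off \<open>S\<close> have no effect, as vectors of the domain
    vanish there.\<close>
  have cong: "diagonal_operator S v = diagonal_operator S w" if "\<And>s. s \<in> S \<Longrightarrow> v s = w s" for v w
  proof -
    have "of_real (v s) * f s = of_real (w s) * f s" if "f \<in> finitely_supported S" for f s
      using \<open>\<And>s. s \<in> S \<Longrightarrow> v s = w s\<close> that by (cases "s \<in> S") (auto simp: finitely_supported_def)
    then show ?thesis by (auto simp: diagonal_operator_def intro!: restrict_ext)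
  qed
  have "gea_morphism E (positive_operator_gea (ell2 S) (finitely_supported S)) ?\<phi>"
    using generalized_stateD[OF S]
    by (auto simp: gea_morphism_def positive_operator_gea_def diagonal_operator_add
        intro!: diagonal_operator_positive cong)
  moreover have "inj_on ?\<phi> (carrier E)"
  proof (rule inj_onI)
    fix a b assume "a \<in> carrier E" "b \<in> carrier E" "?\<phi> a = ?\<phi> b"
    then show "a = b"
      using sep diagonal_operator_inject[of S "\<lambda>s. s a" "\<lambda>s. s b"] by (auto simp: separates_points_def)
  qed
  ultimately show ?thesis
    unfolding operator_representable_def
    using complex_hilbert_space_ell2 dense_subspace_finitely_supported by blast
qed

(* Existence in (ii) and (iii) is asserted over fixed types that are large enough; the last two
   conjuncts, in which 'h and 't are arbitrary, show that a Hilbert space or an index set over any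
   other type yields nothing more. *)
theorem theorem3p3:
  fixes E :: "'a gea"
  assumes "generalized_effect_algebra E"
  shows "(has_separating_states E \<longleftrightarrow>
            operator_representable TYPE(('a \<Rightarrow> real) \<Rightarrow> complex) E) \<and>
         (has_separating_states E \<longleftrightarrow>
            real_power_embeddable TYPE('a \<Rightarrow> real) E) \<and>
         (operator_representable TYPE('h) E \<longrightarrow> has_separating_states E) \<and>
         (real_power_embeddable TYPE('t) E \<longrightarrow> has_separating_states E)"
  using states_imp_operator_representable states_imp_real_power_embeddable
    operator_representable_imp_states real_power_embeddable_imp_states by metis

end
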